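(* Let $T\ge1$ be an integer, let $\lambda_1=2-2\cos\left(\frac{\pi}{T+1}\right)$, let $0<\lambda<\lambda_1$, and put $$\theta=\tan^{-1}\left(\frac{\sqrt{4-(\lambda-2)^2}}{2-\lambda}\right).$$ Then the Green's function $G(t,s)$, $t\in[0,T+1]$, $s\in[1,T]$, of the discrete boundary value problem $$\Delta^2y(t-1)+\lambda y(t)=0,\quad t\in[1,T],\qquad y(0)=0,\quad y(T+1)=0,$$ is given by $$G(t,s)=\begin{cases}-\dfrac{\sin(\theta(T+1-s))\,\sin(\theta t)}{\sin\theta\,\sin(\theta(T+1))}, & 0\le t\le s,\\[3mm] -\dfrac{\sin(\theta(T+1-s))\,\sin(\theta t)}{\sin\theta\,\sin(\theta(T+1))}+\dfrac{\sin(\theta(t-s))}{\sin\theta}, & s\le t\le T+1.\end{cases}$$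
   Context: For integers $a\le b$, $[a,b]$ denotes the discrete interval $\{a,a+1,\dots,b\}$. $\Delta$ is the forward difference operator, $\Delta y(t)=y(t+1)-y(t)$, so $\Delta^2y(t-1)=y(t+1)-2y(t)+y(t-1)$. Write $Ly(t)=\Delta^2y(t-1)+\lambda y(t)$, $t\in[1,T]$. The number $\lambda_1$ is the first eigenvalue of the boundary value problem. The Cauchy function $y(t,s)$ for $Ly=0$ is, for each fixed $s\in[1,T]$, the solution $t\mapsto y(t,s)$ of $Ly=0$ with $y(s,s)=0$, $y(s+1,s)=1$. The Green's function is defined, for each fixed $s\in[1,T]$, by $G(t,s)=u(t,s)$ for $0\le t\le s$ and $G(t,s)=v(t,s)$ for $s\le t\le T+1$. Here $u(\cdot,s)$ is the solution of $Lu=0$ on $[1,T]$ with $u(0,s)=0$ and $u(T+1,s)=-y(T+1,s)$, and $v(t,s)=u(t,s)+y(t,s)$. *)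

theory Defs
  imports Complex_Main
begin

definition fdiff :: "(int \<Rightarrow> real) \<Rightarrow> int \<Rightarrow> real" where
  "fdiff y t = y (t + 1) - y t"

definition Lop :: "real \<Rightarrow> (int \<Rightarrow> real) \<Rightarrow> int \<Rightarrow> real" where
  "Lop lam y t = (fdiff ^^ 2) y (t - 1) + lam * y t"

text \<open>
  Functions on the discrete interval \<open>[0, T+1]\<close> are represented by total functions on
  the integers. For \<open>t\<close> in \<open>[1, T]\<close>, \<open>Lop lam y t\<close> only involves values of \<open>y\<close> on \<open>[0, T+1]\<close>,
  so values elsewhere are unconstrained; uniqueness of any solution below is
  therefore to be understood as uniqueness on \<open>[0, T+1]\<close>.
\<close>

definition solves :: "int \<Rightarrow> real \<Rightarrow> (int \<Rightarrow> real) \<Rightarrow> bool" where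
  "solves T lam y \<longleftrightarrow> (\<forall>t\<in>{1..T}. Lop lam y t = 0)"

definition cauchy_function :: "int \<Rightarrow> real \<Rightarrow> (int \<Rightarrow> int \<Rightarrow> real) \<Rightarrow> bool" where
  "cauchy_function T lam y \<longleftrightarrow>
     (\<forall>s\<in>{1..T}. solves T lam (\<lambda>t. y t s) \<and> y s s = 0 \<and> y (s + 1) s = 1)"

definition green_function :: "int \<Rightarrow> real \<Rightarrow> (int \<Rightarrow> int \<Rightarrow> real) \<Rightarrow> bool" where
  "green_function T lam G \<longleftrightarrow>
     (\<exists>y u v. cauchy_function T lam y \<and>
        (\<forall>s\<in>{1..T}.
           solves T lam (\<lambda>t. u t s) \<and> u 0 s = 0 \<and> u (T + 1) s = - y (T + 1) s \<and>
           (\<forall>t\<in>{0..T+1}. v t s = u t s + y t s) \<and>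
           (\<forall>t\<in>{0..s}. G t s = u t s) \<and>
           (\<forall>t\<in>{s..T+1}. G t s = v t s)))"

end

theory Submission
  imports Defs
begin

text \<open>
  With \<open>lam = 2 - 2 * cos \<theta>\<close> the equation \<open>L y = 0\<close> is the three-term recurrence of \<open>sin (\<theta> * t)\<close>,
  so a solution is determined by two consecutive values through an explicit sine formula. The
  condition \<open>0 < lam < lam1\<close> means \<open>0 < \<theta> < pi / (T + 1)\<close>, whence \<open>sin \<theta>\<close> and \<open>sin (\<theta> * (T + 1))\<close>
  do not vanish and the boundary value problem defining \<open>u\<close> is uniquely solvable.
\<close>

lemma Lop_eq: "Lop lam y t = y (t + 1) - (2 - lam) * y t + y (t - 1)"
  by (simp add: Lop_def fdiff_def numeral_2_eq_2 algebra_simps)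

lemma solves_cos_iff:
  "solves T (2 - 2 * cos \<theta>) y \<longleftrightarrow> (\<forall>t\<in>{1..T}. y (t + 1) + y (t - 1) = 2 * cos \<theta> * y t)"
  unfolding solves_def Lop_eq by (auto simp: algebra_simps)

lemma sin_three_term: "sin (x + \<theta>) + sin (x - \<theta>) = 2 * cos \<theta> * sin (x :: real)"
  by (simp add: sin_add sin_diff)

text \<open>The scaled form of \<open>sin_three_term\<close>. Shift \<open>s\<close> with factor
  \<open>1 / sin \<theta>\<close> yields the Cauchy function; shift 0 yields the part of the Green's
  function that vanishes at 0.\<close>

lemma solves_sin_shift: "solves T (2 - 2 * cos \<theta>) (\<lambda>t. c * sin (\<theta> * of_int (t - s)))"
  unfolding solves_cos_iff
proof
  fix t
  show "c * sin (\<theta> * of_int (t + 1 - s)) + c * sin (\<theta> * of_int (t - 1 - s))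
      = 2 * cos \<theta> * (c * sin (\<theta> * of_int (t - s)))"
    using arg_cong[OF sin_three_term[of "\<theta> * of_int (t - s)" \<theta>], of "\<lambda>z. c * z"]
    by (simp add: algebra_simps)
qed

text \<open>Uniqueness for the initial value problem: the recurrence carries a pair of adjacent
  zeros upwards and downwards through the interval.\<close>

lemma solves_cos_zero:
  assumes "solves T (2 - 2 * cos \<theta>) y" "y s = 0" "y (s + 1) = 0" "s \<in> {0..T}" "t \<in> {0..T + 1}"
  shows "y t = 0"
proof -
  have rec: "y (k + 1) + y (k - 1) = 2 * cos \<theta> * y k" if "k \<in> {1..T}" for k
    using assms(1) that unfolding solves_cos_iff by blast
  have up: "k \<le> T \<longrightarrow> y k = 0 \<and> y (k + 1) = 0" if "s \<le> k" for k
    using that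
  proof (induction k rule: int_ge_induct)
    case base
    then show ?case using assms by simp
  next
    case (step k)
    then show ?case using rec[of "k + 1"] assms(4) by auto
  qed
  have down: "0 \<le> k \<longrightarrow> y k = 0 \<and> y (k + 1) = 0" if "k \<le> s" for k
    using that
  proof (induction k rule: int_le_induct)
    case base
    then show ?case using assms by simp
  next
    case (step k)
    then show ?case using rec[of k] assms(4) by auto
  qed
  \<comment> \<open>The upward induction stops at \<open>k = T\<close>, so the endpoint
    \<open>t = T + 1\<close> is reached as the second entry of the pair at
    \<open>t - 1\<close>.\<close>
  consider "t \<le> s" | "s \<le> t - 1" by linarith
  then show ?thesis
    using up[of "t - 1"] down[of t] assms(5) by cases auto
qed

text \<open>The sine multiple is scaled to agree with \<open>y\<close> at \<open>s\<close> and
  \<open>s + 1\<close>, so the difference has two adjacent zeros.\<close>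

lemma solves_cos_eq_sin:
  assumes "solves T (2 - 2 * cos \<theta>) y" "y s = 0" "sin \<theta> \<noteq> 0" "s \<in> {0..T}" "t \<in> {0..T + 1}"
  shows "y t = y (s + 1) / sin \<theta> * sin (\<theta> * of_int (t - s))"
proof -
  let ?c = "y (s + 1) / sin \<theta>"
  let ?z = "\<lambda>t. y t - ?c * sin (\<theta> * of_int (t - s))"
  have "solves T (2 - 2 * cos \<theta>) ?z"
    using assms(1) solves_sin_shift[of T \<theta> ?c s]
    unfolding solves_cos_iff right_diff_distrib by (force simp: algebra_simps)
  then have "?z t = 0"
    by (rule solves_cos_zero[where s = s]) (use assms in auto)
  then show ?thesis by simp
qed

text \<open>With \<open>c = (2 - lam) / 2\<close> the argument is \<open>sqrt (1 - c^2) / c\<close>,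
  the tangent of \<open>arccos c\<close>. Since \<open>c\<close> is positive,
  \<open>arccos c\<close> lies in the range of \<open>arctan\<close>.\<close>

lemma arctan_cos_eq:
  fixes lam :: real
  assumes "0 < lam" "lam < 2"
  shows "arctan (sqrt (4 - (lam - 2)^2) / (2 - lam)) = arccos ((2 - lam) / 2)"
proof -
  let ?c = "(2 - lam) / 2"
  have c: "0 < ?c" "?c < 1" using assms by auto
  have "sqrt (4 - (lam - 2)^2) = sqrt (4 * (1 - ?c^2))"
    by (simp add: field_simps power2_eq_square)
  also have "\<dots> = 2 * sqrt (1 - ?c^2)"
    by (simp only: real_sqrt_mult real_sqrt_four)
  finally have *: "sqrt (4 - (lam - 2)^2) / (2 - lam) = sqrt (1 - ?c^2) / ?c"
    using assms by (simp add: field_simps)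
  have "tan (arccos ?c) = sqrt (1 - ?c^2) / ?c"
    using c by (simp add: tan_def sin_arccos cos_arccos del: divide_le_eq_1)
  moreover have "- (pi / 2) < arccos ?c" "arccos ?c < pi / 2"
    using c arccos_lt_bounded[of ?c] arccos_less_arccos[of 0 ?c] by auto
  ultimately show ?thesis
    unfolding * using arctan_tan by metis
qed

lemma angle_bounds:
  fixes T :: int and lam \<theta> :: real
  assumes "T \<ge> 1" "0 < lam" "lam < 2 - 2 * cos (pi / of_int (T + 1))"
    and "\<theta> = arctan (sqrt (4 - (lam - 2)^2) / (2 - lam))"
  shows "lam = 2 - 2 * cos \<theta>" "0 < \<theta>" "\<theta> * of_int (T + 1) < pi" "\<theta> < pi"
proof -
  \<comment> \<open>From \<open>T + 1 \<ge> 2\<close> the angle \<open>pi / (T + 1)\<close> is at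
    most \<open>pi / 2\<close>; its cosine is then nonnegative, which forces
    \<open>lam < 2\<close>.\<close>
  have T: "2 \<le> real_of_int (T + 1)" using assms(1) by simp
  have p: "0 \<le> pi / of_int (T + 1)" "pi / of_int (T + 1) \<le> pi / 2"
    using T divide_left_mono[OF T, of pi] by auto
  have "0 \<le> cos (pi / of_int (T + 1))"
    using p by (intro cos_ge_zero) auto
  then have lam: "lam < 2" using assms(3) by linarith
  have \<theta>: "\<theta> = arccos ((2 - lam) / 2)"
    using assms(2,4) lam arctan_cos_eq by simp
  have c: "- 1 < (2 - lam) / 2" "(2 - lam) / 2 < 1"
    using assms(2) lam by auto
  have cos: "cos \<theta> = (2 - lam) / 2"
    unfolding \<theta> using c by (intro cos_arccos) linarith+
  then show "lam = 2 - 2 * cos \<theta>" by simp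
  show "0 < \<theta>" "\<theta> < pi" using arccos_lt_bounded[OF c] \<theta> by auto
  \<comment> \<open>The eigenvalue bound compares cosines; strict monotonicity on
    \<open>[0, pi]\<close> turns it into a bound on angles.\<close>
  have "cos (pi / of_int (T + 1)) < cos \<theta>" using cos assms(3) by simp
  then have "\<theta> < pi / of_int (T + 1)"
    using p \<open>0 < \<theta>\<close> \<open>\<theta> < pi\<close> by (subst (asm) cos_mono_less_eq) linarith+
  then show "\<theta> * of_int (T + 1) < pi" using T by (simp add: field_simps)
qed

theorem lemma2p1:
  fixes T :: int and lam lam1 \<theta> :: real and G :: "int \<Rightarrow> int \<Rightarrow> real"
  assumes "T \<ge> 1"
    and "lam1 = 2 - 2 * cos (pi / of_int (T + 1))"
    and "0 < lam" and "lam < lam1"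
    and "\<theta> = arctan (sqrt (4 - (lam - 2)^2) / (2 - lam))"
  shows "green_function T lam G \<longleftrightarrow>
    (\<forall>s\<in>{1..T}.
       (\<forall>t\<in>{0..s}. G t s =
          - ((sin (\<theta> * of_int (T + 1 - s)) * sin (\<theta> * of_int t))
            / (sin \<theta> * sin (\<theta> * of_int (T + 1))))) \<and>
       (\<forall>t\<in>{s..T+1}. G t s =
          - ((sin (\<theta> * of_int (T + 1 - s)) * sin (\<theta> * of_int t))
            / (sin \<theta> * sin (\<theta> * of_int (T + 1))))
          + sin (\<theta> * of_int (t - s)) / sin \<theta>))"
proof -
  have lam: "lam = 2 - 2 * cos \<theta>" and pos: "0 < \<theta>" "\<theta> * of_int (T + 1) < pi" "\<theta> < pi"
    using angle_bounds[of T lam \<theta>] assms by auto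
  have s1: "sin \<theta> \<noteq> 0" using sin_gt_zero[of \<theta>] pos by simp
  have "0 < \<theta> * of_int (T + 1)" using pos(1) assms(1) by simp
  then have sT: "sin (\<theta> * of_int (T + 1)) \<noteq> 0" using sin_gt_zero pos(2) by force
  define y where "y t s = sin (\<theta> * of_int (t - s)) / sin \<theta>" for t s :: int
  define u where "u t s = - ((sin (\<theta> * of_int (T + 1 - s)) * sin (\<theta> * of_int t))
      / (sin \<theta> * sin (\<theta> * of_int (T + 1))))" for t s :: int
  have y: "solves T lam (\<lambda>t. y t s)" for s
    using solves_sin_shift[of T \<theta> "1 / sin \<theta>" s] by (simp add: y_def lam)
  have u: "solves T lam (\<lambda>t. u t s)" for s
    using solves_sin_shift[of T \<theta>
        "- (sin (\<theta> * of_int (T + 1 - s)) / (sin \<theta> * sin (\<theta> * of_int (T + 1))))" 0]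
    by (simp add: u_def lam)
  have cauchy: "cauchy_function T lam y"
    unfolding cauchy_function_def using y s1 by (simp add: y_def)
  have u_bd: "u 0 s = 0" "u (T + 1) s = - y (T + 1) s" for s
    using s1 sT by (simp_all add: u_def y_def)
  have y_unique: "y' t s = y t s"
    if "cauchy_function T lam y'" "s \<in> {1..T}" "t \<in> {0..T + 1}" for y' s t
    using solves_cos_eq_sin[of T \<theta> "\<lambda>t. y' t s" s t] that s1
    unfolding cauchy_function_def lam y_def by auto
  \<comment> \<open>A solution vanishing at 0 is a multiple of \<open>sin (\<theta> * t)\<close>,
    and its value at \<open>T + 1\<close> fixes the factor because
    \<open>sin (\<theta> * (T + 1))\<close> is nonzero.\<close>
  have u_unique: "w t = u t s"
    if "solves T lam w" "w 0 = 0" "w (T + 1) = - y (T + 1) s" "t \<in> {0..T + 1}" for w s t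
  proof -
    have *: "w k = w 1 / sin \<theta> * sin (\<theta> * of_int k)" if "k \<in> {0..T + 1}" for k
      using solves_cos_eq_sin[of T \<theta> w 0 k] \<open>solves T lam w\<close> \<open>w 0 = 0\<close> s1 that assms(1)
      unfolding lam by simp
    have "w 1 / sin \<theta> * sin (\<theta> * of_int (T + 1)) = - y (T + 1) s"
      using *[of "T + 1"] that(3) assms(1) by simp
    then have "w 1 / sin \<theta> = - y (T + 1) s / sin (\<theta> * of_int (T + 1))"
      using sT by (metis nonzero_mult_div_cancel_right)
    then show ?thesis
      using *[OF that(4)] by (simp add: u_def y_def)
  qed
  have "green_function T lam G \<longleftrightarrow>
      (\<forall>s\<in>{1..T}. (\<forall>t\<in>{0..s}. G t s = u t s) \<and> (\<forall>t\<in>{s..T+1}. G t s = u t s + y t s))"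
    (is "_ \<longleftrightarrow> ?R")
  proof
    assume "green_function T lam G"
    then obtain y' u' v' where y': "cauchy_function T lam y'" and
      G: "\<And>s. s \<in> {1..T} \<Longrightarrow> solves T lam (\<lambda>t. u' t s) \<and> u' 0 s = 0 \<and> u' (T + 1) s = - y' (T + 1) s \<and>
           (\<forall>t\<in>{0..T+1}. v' t s = u' t s + y' t s) \<and>
           (\<forall>t\<in>{0..s}. G t s = u' t s) \<and> (\<forall>t\<in>{s..T+1}. G t s = v' t s)"
      unfolding green_function_def by blast
    show ?R
    proof
      fix s assume s: "s \<in> {1..T}"
      \<comment> \<open>The Cauchy function is identified first, because its value at
        \<open>T + 1\<close> is the boundary datum for \<open>u'\<close>.\<close>
      have yy: "y' t s = y t s" if "t \<in> {0..T + 1}" for t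
        using y_unique[OF y' s that] .
      have "u' t s = u t s" if "t \<in> {0..T + 1}" for t
        using u_unique[of "\<lambda>t. u' t s" s t] G[OF s] yy[of "T + 1"] that assms(1) by simp
      then show "(\<forall>t\<in>{0..s}. G t s = u t s) \<and> (\<forall>t\<in>{s..T+1}. G t s = u t s + y t s)"
        using G[OF s] yy s by auto
    qed
  next
    assume ?R
    then show "green_function T lam G"
      unfolding green_function_def using cauchy u u_bd
      by (intro exI[of _ y] exI[of _ u] exI[of _ "\<lambda>t s. u t s + y t s"]) auto
  qed
  then show ?thesis
    unfolding u_def y_def .
qed

end
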